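(* For each real number $u>0$, $$u=\lim_{m\to\infty}\prod_{k=1}^{m}(k+u)^{\binom{m}{k}(-1)^{k+1}}=\prod_{m=0}^{\infty}\left(\prod_{k=0}^{m}(k+u+1)^{\binom{m}{k}(-1)^{k}}\right).$$
   Context: Here $\binom{m}{k}$ denotes the binomial coefficient. In the exponents, $\binom{m}{k}(-1)^{k+1}$ and $\binom{m}{k}(-1)^{k}$ are the products of the binomial coefficient with the sign. The infinite product over $m$ is the limit, as $M\to\infty$, of the partial products over $0\le m\le M$ of the finite inner products. *)

theory Defs imports "HOL-Analysis.Infinite_Products" begin

end

theory Submission imports Defs "HOL-Analysis.Gamma_Function" begin

text \<open>
  Write \<open>\<Delta>\<^sup>m f\<close> for the alternating binomial sum \<open>\<Sum>k\<le>m. (-1)^k (m choose k) f (u + k)\<close>. On taking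
  logarithms, the first product becomes \<open>ln u - \<Delta>\<^sup>m ln u\<close>. Pascal's rule
  \<open>\<Delta>\<^sup>m f (u + 1) = \<Delta>\<^sup>m f u - \<Delta>\<^sup>m\<^sup>+\<^sup>1 f u\<close> makes the logarithm of the infinite product
  telescope, with partial sums \<open>ln u - \<Delta>\<^sup>M\<^sup>+\<^sup>1 ln u\<close>. Both claims therefore say that
  \<open>\<Delta>\<^sup>m ln u\<close> tends to 0 as \<open>m\<close> grows.

  To see this, differentiate in \<open>u\<close>: the derivative of \<open>\<Delta>\<^sup>m ln\<close> is \<open>m! / (u (u+1) \<dots> (u+m))\<close>
  (\<open>alt_diff_inverse\<close>), which is positive, decreasing in \<open>u\<close>, and tends to 0 like
  \<open>\<Gamma>(u) m\<^sup>-\<^sup>u\<close> by Euler's limit for the Gamma function. Since \<open>\<Delta>\<^sup>m ln\<close> vanishes at infinity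
  for \<open>m \<ge> 1\<close>, monotonicity makes it nonpositive, and then Pascal's rule makes it increase
  with \<open>m\<close>. Hence its value at a far point \<open>x\<close> is at least \<open>\<Delta>\<^sup>1 ln x = - ln (1 + 1/x)\<close>, which
  is small uniformly in \<open>m\<close>, while the mean value theorem bounds the change from \<open>u\<close> to \<open>x\<close>
  by \<open>x - u\<close> times a derivative that tends to 0. These two estimates are \<open>alt_diff_ln_lower\<close> and
  \<open>alt_diff_ln_mvt_bounds\<close>.
\<close>

definition alt_diff :: "(real \<Rightarrow> real) \<Rightarrow> nat \<Rightarrow> real \<Rightarrow> real" where
  "alt_diff f m u = (\<Sum>k\<le>m. (-1) ^ k * real (m choose k) * f (u + real k))"

lemma alt_diff_0 [simp]: "alt_diff f 0 u = f u"
  by (simp add: alt_diff_def)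

lemma alt_diff_Suc: "alt_diff f (Suc m) u = alt_diff f m u - alt_diff f m (u + 1)"
proof -
  have "alt_diff f (Suc m) u =
      f u + (\<Sum>k\<le>m. (-1) ^ Suc k * real (Suc m choose Suc k) * f (u + real (Suc k)))"
    unfolding alt_diff_def by (subst sum.atMost_Suc_shift) simp
  also have "\<dots> = f u + (\<Sum>k\<le>m. (-1) ^ Suc k * real (m choose Suc k) * f (u + real (Suc k)))
      - alt_diff f m (u + 1)"
    by (simp add: alt_diff_def algebra_simps sum.distrib sum_subtractf sum_negf)
  also have "f u + (\<Sum>k\<le>m. (-1) ^ Suc k * real (m choose Suc k) * f (u + real (Suc k)))
      = (\<Sum>k\<le>Suc m. (-1) ^ k * real (m choose k) * f (u + real k))"
    by (subst sum.atMost_Suc_shift) simp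
  also have "\<dots> = alt_diff f m u"
    by (simp add: alt_diff_def)
  finally show ?thesis .
qed

lemma sum_alt_diff_shift: "(\<Sum>m\<le>M. alt_diff f m (u + 1)) = f u - alt_diff f (Suc M) u"
proof (induction M)
  case (Suc M)
  then show ?case
    using alt_diff_Suc[of f "Suc M" u] by simp
qed (simp add: alt_diff_Suc)

text \<open>
  Pascal's rule for the left-hand side matches the partial fraction identity
  \<open>1 / (u \<dots> (u+m)) - 1 / ((u+1) \<dots> (u+m+1)) = (m+1) / (u \<dots> (u+m+1))\<close> on the right.
\<close>
lemma alt_diff_inverse:
  assumes "u > 0"
  shows "alt_diff inverse m u = fact m / pochhammer u (Suc m)"
  using assms
proof (induction m arbitrary: u)
  case 0
  then show ?case by (simp add: field_simps)
next
  case (Suc m)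
  define p where "p = pochhammer (u + 1) m"
  have p: "p > 0" using Suc.prems by (simp add: p_def pochhammer_pos)
  have 1: "pochhammer u (Suc m) = u * p"
    by (simp add: p_def pochhammer_rec)
  have 2: "pochhammer (u + 1) (Suc m) = p * (u + 1 + real m)"
    by (simp add: p_def pochhammer_rec')
  have 3: "pochhammer u (Suc (Suc m)) = u * (p * (u + 1 + real m))"
    by (subst pochhammer_rec) (simp add: 2)
  have "alt_diff inverse (Suc m) u = fact m / (u * p) - fact m / (p * (u + 1 + real m))"
    using Suc.IH[of u] Suc.IH[of "u + 1"] Suc.prems by (simp add: alt_diff_Suc 1 2)
  also have "\<dots> = fact (Suc m) / (u * (p * (u + 1 + real m)))"
    using p Suc.prems by (simp add: divide_simps) (simp add: algebra_simps)
  finally show ?case by (simp only: 3)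
qed

lemma alt_diff_inverse_pos: "u > 0 \<Longrightarrow> alt_diff inverse m u > 0"
  by (simp add: alt_diff_inverse pochhammer_pos)

lemma alt_diff_inverse_antimono:
  assumes "0 < u" "u \<le> v"
  shows "alt_diff inverse m v \<le> alt_diff inverse m u"
proof -
  have "pochhammer u (Suc m) \<le> pochhammer v (Suc m)"
    unfolding pochhammer_prod using assms by (intro prod_mono) auto
  then show ?thesis
    using assms by (simp add: alt_diff_inverse frac_le pochhammer_pos)
qed

text \<open>
  The closed form is the \<open>m\<close>-th term of Euler's sequence for \<open>\<Gamma>(u)\<close> divided by \<open>m\<^sup>u\<close>; as that
  sequence converges, the quotient tends to 0, however small \<open>u > 0\<close> is.
\<close>
lemma alt_diff_inverse_tendsto_0:
  assumes "u > 0"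
  shows "(\<lambda>m. alt_diff inverse m u) \<longlonglongrightarrow> 0"
proof -
  have eq: "alt_diff inverse m u = Gamma_series u m * exp (- (u * ln (real m)))" for m
    using assms by (simp add: alt_diff_inverse Gamma_series_def exp_minus)
  have "filterlim (\<lambda>m. u * ln (real m)) at_top sequentially"
    using assms
    by (intro filterlim_tendsto_pos_mult_at_top[OF tendsto_const]
          filterlim_compose[OF ln_at_top] filterlim_real_sequentially)
  then have "(\<lambda>m. exp (- (u * ln (real m)))) \<longlonglongrightarrow> 0"
    by (intro filterlim_compose[OF exp_at_bot]) (simp add: filterlim_uminus_at_top[symmetric])
  with Gamma_series_LIMSEQ[of u]
  have "(\<lambda>m. Gamma_series u m * exp (- (u * ln (real m)))) \<longlonglongrightarrow> Gamma u * 0"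
    by (rule tendsto_mult)
  then show ?thesis
    by (simp add: eq)
qed

lemma DERIV_alt_diff_ln:
  assumes "u > 0"
  shows "(alt_diff ln m has_real_derivative alt_diff inverse m u) (at u)"
proof -
  have "((\<lambda>u. (-1) ^ k * real (m choose k) * ln (u + real k)) has_real_derivative
      (-1) ^ k * real (m choose k) * inverse (u + real k)) (at u)" for k
    using assms by (intro DERIV_cmult DERIV_ln[THEN DERIV_shift[THEN iffD1]]) auto
  then show ?thesis
    unfolding alt_diff_def by (intro DERIV_sum)
qed

text \<open>
  The alternating sum of a row of Pascal's triangle is 0, so \<open>ln (u + k)\<close> may be replaced by
  \<open>ln (1 + k/u)\<close>, and each of these finitely many terms tends to 0.
\<close>
lemma alt_diff_ln_at_top:
  assumes "m > 0"
  shows "(alt_diff ln m \<longlongrightarrow> 0) at_top"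
proof -
  have "((\<lambda>u. 1 + real k * inverse u) \<longlongrightarrow> 1 + real k * 0) at_top" for k
    by (intro tendsto_intros tendsto_inverse_0_at_top filterlim_ident)
  then have "((\<lambda>u. ln (1 + real k * inverse u)) \<longlongrightarrow> ln 1) at_top" for k
    by (intro tendsto_ln) auto
  then have "((\<lambda>u. \<Sum>k\<le>m. (-1) ^ k * real (m choose k) * ln (1 + real k * inverse u)) \<longlongrightarrow>
      (\<Sum>k\<le>m. (-1) ^ k * real (m choose k) * ln 1)) at_top"
    by (intro tendsto_sum tendsto_mult tendsto_const)
  moreover have "alt_diff ln m u = (\<Sum>k\<le>m. (-1) ^ k * real (m choose k) * ln (1 + real k * inverse u))"
    if "u > 0" for u
  proof -
    have "ln (u + real k) = ln u + ln (1 + real k * inverse u)" for k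
    proof -
      have "u + real k = u * (1 + real k * inverse u)"
        using that by (simp add: field_simps)
      moreover have "1 + real k * inverse u > 0"
        using that by (intro add_pos_nonneg) auto
      ultimately show ?thesis
        using that by (simp only: ln_mult_pos)
    qed
    then have "alt_diff ln m u = (\<Sum>k\<le>m. (-1) ^ k * real (m choose k)) * ln u
        + (\<Sum>k\<le>m. (-1) ^ k * real (m choose k) * ln (1 + real k * inverse u))"
      by (simp only: alt_diff_def distrib_left sum.distrib sum_distrib_right)
    then show ?thesis
      using choose_alternating_sum[OF assms, where 'a = real] by simp
  qed
  then have "\<forall>\<^sub>F u in at_top.
      (\<Sum>k\<le>m. (-1) ^ k * real (m choose k) * ln (1 + real k * inverse u)) = alt_diff ln m u"
    by (intro eventually_mono[OF eventually_gt_at_top[of 0]]) simp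
  ultimately show ?thesis
    by (simp add: Lim_transform_eventually)
qed

lemma alt_diff_ln_mvt_bounds:
  assumes "0 < u" "u \<le> x"
  shows "alt_diff ln m u \<le> alt_diff ln m x"
    and "alt_diff ln m x - alt_diff ln m u \<le> (x - u) * alt_diff inverse m u"
proof -
  have "alt_diff ln m u \<le> alt_diff ln m x \<and>
      alt_diff ln m x - alt_diff ln m u \<le> (x - u) * alt_diff inverse m u"
  proof (cases "u = x")
    case False
    with assms have "u < x" by simp
    then obtain z where z: "u < z" "z < x"
      "alt_diff ln m x - alt_diff ln m u = (x - u) * alt_diff inverse m z"
      using MVT2[of u x "alt_diff ln m" "alt_diff inverse m"] DERIV_alt_diff_ln assms
      by (metis less_le_trans)
    have "0 \<le> (x - u) * alt_diff inverse m z"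
      using alt_diff_inverse_pos[of z m] assms z by simp
    moreover have "(x - u) * alt_diff inverse m z \<le> (x - u) * alt_diff inverse m u"
      using alt_diff_inverse_antimono[of u z m] assms z by (intro mult_left_mono) auto
    ultimately show ?thesis using z by linarith
  qed simp
  then show "alt_diff ln m u \<le> alt_diff ln m x"
    and "alt_diff ln m x - alt_diff ln m u \<le> (x - u) * alt_diff inverse m u"
    by auto
qed

lemma alt_diff_ln_nonpos:
  assumes "m > 0" "u > 0"
  shows "alt_diff ln m u \<le> 0"
proof (rule tendsto_lowerbound[OF alt_diff_ln_at_top[OF assms(1)]])
  show "\<forall>\<^sub>F x in at_top. alt_diff ln m u \<le> alt_diff ln m x"
    using eventually_ge_at_top[of u] by eventually_elim (rule alt_diff_ln_mvt_bounds(1)[OF assms(2)])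
qed simp

text \<open>
  The case \<open>m = 0\<close> is \<open>ln (1 + 1/u) \<le> 1/u\<close>, and raising the order can only increase the value:
  by Pascal's rule the increment is \<open>- \<Delta>\<^sup>m\<^sup>+\<^sup>1 ln (u + 1)\<close>, which is nonnegative. The point of the
  bound is that it is uniform in \<open>m\<close>.
\<close>
lemma alt_diff_ln_lower:
  assumes "u > 0"
  shows "- (1 / u) \<le> alt_diff ln (Suc m) u"
proof (induction m)
  case 0
  have "u * (1 + 1 / u) = u + 1"
    using assms by (simp add: field_simps)
  moreover have "ln (u * (1 + 1 / u)) = ln u + ln (1 + 1 / u)"
    using assms by (intro ln_mult_pos add_pos_pos) auto
  ultimately have "ln (u + 1) - ln u = ln (1 + 1 / u)"
    by (simp only: add_diff_cancel_left')
  also have "\<dots> \<le> 1 / u"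
    using assms by (intro ln_add_one_self_le_self) auto
  finally show ?case by (simp add: alt_diff_Suc)
next
  case (Suc m)
  have "alt_diff ln (Suc m) (u + 1) \<le> 0"
    using assms by (intro alt_diff_ln_nonpos) auto
  with Suc show ?case
    by (simp only: alt_diff_Suc[of ln "Suc m" u])
qed

lemma alt_diff_ln_tendsto_0:
  assumes "u > 0"
  shows "(\<lambda>m. alt_diff ln m u) \<longlonglongrightarrow> 0"
proof (rule LIMSEQ_I)
  fix e :: real assume "e > 0"
  \<comment> \<open>Half of \<open>e\<close> is spent on the tail beyond \<open>x\<close>, half on the passage from \<open>u\<close> to \<open>x\<close>.\<close>
  define x where "x = u + 2 / e"
  have "x > u" using \<open>e > 0\<close> by (simp add: x_def)
  have "1 / x < 1 / (2 / e)"
    unfolding x_def using \<open>e > 0\<close> assms by (intro divide_strict_left_mono mult_pos_pos add_pos_pos) auto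
  then have "1 / x < e / 2" by simp
  have "(\<lambda>m. (x - u) * alt_diff inverse m u) \<longlonglongrightarrow> (x - u) * 0"
    by (intro tendsto_intros alt_diff_inverse_tendsto_0 assms)
  then have "\<forall>\<^sub>F m in sequentially. (x - u) * alt_diff inverse m u < e / 2"
    using \<open>e > 0\<close> by (intro order_tendstoD) auto
  then have "\<forall>\<^sub>F m in sequentially. norm (alt_diff ln m u - 0) < e"
    using eventually_gt_at_top[of 0]
  proof eventually_elim
    case (elim m)
    have "- (1 / x) \<le> alt_diff ln m x"
      using alt_diff_ln_lower[of x "m - 1"] assms \<open>x > u\<close> elim by simp
    moreover have "alt_diff ln m u \<le> 0"
      using alt_diff_ln_nonpos assms elim by simp
    ultimately show ?case
      using alt_diff_ln_mvt_bounds(2)[of u x m] assms \<open>x > u\<close> \<open>1 / x < e / 2\<close> elim(1) by simp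
  qed
  then show "\<exists>N. \<forall>m\<ge>N. norm (alt_diff ln m u - 0) < e"
    by (simp add: eventually_sequentially)
qed

lemma powi_eq_exp_ln: "x > 0 \<Longrightarrow> x powi n = exp (of_int n * ln x)" for x :: real
  using exp_power_int[of "ln x" n] by simp

lemma prod_powi_eq_exp_alt_diff:
  assumes "u > 0"
  shows "(\<Prod>k\<le>m. (real k + u) powi (int (m choose k) * (-1) ^ k)) = exp (alt_diff ln m u)"
proof -
  have "(real k + u) powi (int (m choose k) * (-1) ^ k)
      = exp ((-1) ^ k * real (m choose k) * ln (u + real k))" for k
    using powi_eq_exp_ln[of "real k + u" "int (m choose k) * (-1) ^ k"] assms
    by (simp add: mult.commute add.commute)
  then show ?thesis
    by (simp only: alt_diff_def exp_sum[OF finite_atMost])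
qed

theorem corollary3:
  fixes u :: real
  assumes "u > 0"
  shows "(\<lambda>m. \<Prod>k=1..m. (real k + u) powi (int (m choose k) * (-1) ^ (k + 1))) \<longlonglongrightarrow> u \<and>
         (\<lambda>m. \<Prod>k=0..m. (real k + u + 1) powi (int (m choose k) * (-1) ^ k)) has_prod u"
proof
  have first: "(\<Prod>k=1..m. (real k + u) powi (int (m choose k) * (-1) ^ (k + 1)))
      = exp (ln u - alt_diff ln m u)" for m
  proof -
    define Q where "Q = (\<Prod>k=1..m. (real k + u) powi (int (m choose k) * (-1) ^ k))"
    have "(\<Prod>k\<le>m. (real k + u) powi (int (m choose k) * (-1) ^ k)) = u * Q"
      by (simp add: Q_def atMost_atLeast0 prod.atLeast_Suc_atMost[of 0 m])
    then have "exp (alt_diff ln m u) = u * Q"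
      by (simp only: prod_powi_eq_exp_alt_diff[OF assms])
    then have "exp (ln u - alt_diff ln m u) = inverse Q"
      using assms by (simp add: exp_diff inverse_eq_divide)
    also have "inverse Q = (\<Prod>k=1..m. inverse ((real k + u) powi (int (m choose k) * (-1) ^ k)))"
      unfolding Q_def using prod_inversef[of "\<lambda>k. (real k + u) powi (int (m choose k) * (-1) ^ k)"]
      by (simp only: o_def)
    also have "\<dots> = (\<Prod>k=1..m. (real k + u) powi (int (m choose k) * (-1) ^ (k + 1)))"
      by (intro prod.cong refl) (simp add: power_int_minus)
    finally show ?thesis ..
  qed
  have "(\<lambda>m. exp (ln u - alt_diff ln m u)) \<longlonglongrightarrow> exp (ln u - 0)"
    by (intro tendsto_intros alt_diff_ln_tendsto_0 assms)
  then show "(\<lambda>m. \<Prod>k=1..m. (real k + u) powi (int (m choose k) * (-1) ^ (k + 1))) \<longlonglongrightarrow> u"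
    using assms by (simp only: first) simp
  have factor: "(\<Prod>k=0..m. (real k + u + 1) powi (int (m choose k) * (-1) ^ k))
      = exp (alt_diff ln m (u + 1))" for m
    using prod_powi_eq_exp_alt_diff[of "u + 1" m] assms
    by (simp add: atMost_atLeast0 add.assoc)
  have "(\<lambda>M. exp (ln u - alt_diff ln (Suc M) u)) \<longlonglongrightarrow> exp (ln u - 0)"
    by (intro tendsto_intros LIMSEQ_Suc[OF alt_diff_ln_tendsto_0] assms)
  then have "(\<lambda>M. \<Prod>m\<le>M. exp (alt_diff ln m (u + 1))) \<longlonglongrightarrow> u"
    using assms by (simp only: exp_sum[OF finite_atMost, symmetric] sum_alt_diff_shift) simp
  then show "(\<lambda>m. \<Prod>k=0..m. (real k + u + 1) powi (int (m choose k) * (-1) ^ k)) has_prod u"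
    using assms by (simp add: factor has_prod_def raw_has_prod_def)
qed

end
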